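(* Consider an $(\overline{n},\overline{k})$ MSR code over a finite field $\mathbf{F}_q$ (the base code) with sub-packetization level $N$, repair degree $\overline{d}<\overline{n}-1$ and parity-check matrix $(\overline{A}_{t,i})_{t\in[0:r),\,i\in[0:\overline{n})}$, where $r=\overline{n}-\overline{k}$. Let $s\ge 2$, $n=s\overline{n}$, $k=n-r$, and let the new $(n,k)$ array code obtained by the generic transformation be the one with parity-check matrix $(A_{t,j})_{t\in[0:r),\,j\in[0:n)}$, $A_{t,j}=x_{t,j}\,\overline{A}_{t,\,j\%\overline{n}}$, where $x_{t,j}\in\mathbf{F}_q\setminus\{0\}$. Suppose that i) $q>N\binom{n-1}{r-1}+1$; ii) every block matrix $\overline{A}_{t,j}$, $t\in[0:r)$, $j\in[0:\overline{n})$, of the base code is non-singular. Then there exists an assignment of the coefficients $x_{t,j}\in\mathbf{F}_q\setminus\{0\}$ ($t\in[0:r)$, $j\in[0:n)$) such that the new $(n,k)$ array code is MDS.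
   Context: Notation: $[a:b)=\{a,a+1,\dots,b-1\}$; $\%$ is the modulo operation. Array codes: an $(n,k)$ array code over $\mathbf{F}_q$ with sub-packetization level $N$ and parity-check matrix $(A_{t,i})_{t\in[0:r),i\in[0:n)}$ ($r=n-k$, each $A_{t,i}$ an $N\times N$ matrix over $\mathbf{F}_q$) is the set of $(\mathbf{f}_0,\dots,\mathbf{f}_{n-1})$, $\mathbf{f}_i\in\mathbf{F}_q^N$ column vectors (node $i$ stores $\mathbf{f}_i$), with $\sum_{i=0}^{n-1}A_{t,i}\mathbf{f}_i=0$ for all $t\in[0:r)$. It is MDS if the codeword is determined by any $k$ of the $n$ nodes, i.e. every $r\times r$ sub-block matrix $(A_{t,i_j})_{t,j\in[0:r)}$, $0\le i_0<\dots<i_{r-1}<n$, is non-singular. An $(\overline{n},\overline{k})$ MSR code with repair degree $\overline{d}$ is an $(\overline{n},\overline{k})$ MDS array code in which any node can be repaired from any $\overline{d}$ other nodes by downloading a total of $\frac{\overline{d}}{\overline{d}-\overline{k}+1}N$ symbols (the minimum possible). *)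

theory Defs
  imports "Jordan_Normal_Form.Matrix" "HOL-Library.FuncSet" "HOL-Library.Cardinality"
begin

text \<open>
  The parity-check matrix is given by its blocks \<open>A t i\<close> for \<open>t < n - k\<close> and \<open>i < n\<close>; block
  indices outside this range are irrelevant.
\<close>

definition parity_check_blocks :: "nat \<Rightarrow> nat \<Rightarrow> nat \<Rightarrow> (nat \<Rightarrow> nat \<Rightarrow> 'a mat) \<Rightarrow> bool" where
  "parity_check_blocks n k N A \<longleftrightarrow>
     0 < k \<and> k < n \<and> 0 < N \<and> (\<forall>t<n - k. \<forall>i<n. A t i \<in> carrier_mat N N)"

text \<open>
  Codewords are extensional functions on \<open>{..<n}\<close>, so that equality of codewords is equality of
  the contents of the \<open>n\<close> nodes.
\<close>

definition array_code ::
  "nat \<Rightarrow> nat \<Rightarrow> nat \<Rightarrow> (nat \<Rightarrow> nat \<Rightarrow> 'a::field mat) \<Rightarrow> (nat \<Rightarrow> 'a vec) set" where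
  "array_code n k N A =
     {f \<in> {..<n} \<rightarrow>\<^sub>E carrier_vec N.
        \<forall>t<n - k. finsum_vec TYPE('a) N (\<lambda>i. A t i *\<^sub>v f i) {..<n} = 0\<^sub>v N}"

definition mds_array_code ::
  "nat \<Rightarrow> nat \<Rightarrow> nat \<Rightarrow> (nat \<Rightarrow> nat \<Rightarrow> 'a::field mat) \<Rightarrow> bool" where
  "mds_array_code n k N A \<longleftrightarrow>
     parity_check_blocks n k N A \<and>
     (\<forall>K. K \<subseteq> {..<n} \<and> card K = k \<longrightarrow> inj_on (\<lambda>f. restrict f K) (array_code n k N A))"

text \<open>
  Node \<open>i\<close> is repaired from the helper nodes in \<open>D\<close>: helper \<open>j\<close> sends \<open>\<beta> j\<close> symbols computed by
  \<open>h j\<close> from its own content, and \<open>g\<close> recovers the content of node \<open>i\<close> from all the data sent.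
  The functions \<open>h j\<close> and \<open>g\<close> are not required to be linear.
\<close>

definition repairable ::
  "nat \<Rightarrow> (nat \<Rightarrow> 'a vec) set \<Rightarrow> nat \<Rightarrow> nat set \<Rightarrow> real \<Rightarrow> bool" where
  "repairable N C i D bandwidth \<longleftrightarrow>
     (\<exists>(\<beta> :: nat \<Rightarrow> nat) (h :: nat \<Rightarrow> 'a vec \<Rightarrow> 'a vec) (g :: (nat \<Rightarrow> 'a vec) \<Rightarrow> 'a vec).
        (\<forall>j\<in>D. h j \<in> carrier_vec N \<rightarrow> carrier_vec (\<beta> j)) \<and>
        real (\<Sum>j\<in>D. \<beta> j) = bandwidth \<and>
        (\<forall>f\<in>C. g (\<lambda>j\<in>D. h j (f j)) = f i))"

definition msr_code ::
  "nat \<Rightarrow> nat \<Rightarrow> nat \<Rightarrow> nat \<Rightarrow> (nat \<Rightarrow> nat \<Rightarrow> 'a::field mat) \<Rightarrow> bool" where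
  "msr_code n k d N A \<longleftrightarrow>
     mds_array_code n k N A \<and> k \<le> d \<and> d < n \<and>
     (\<forall>i<n. \<forall>D. D \<subseteq> {..<n} - {i} \<and> card D = d \<longrightarrow>
        repairable N (array_code n k N A) i D (real d / (real d - real k + 1) * real N))"

definition transformed_blocks ::
  "nat \<Rightarrow> (nat \<Rightarrow> nat \<Rightarrow> 'a::field) \<Rightarrow> (nat \<Rightarrow> nat \<Rightarrow> 'a mat) \<Rightarrow> nat \<Rightarrow> nat \<Rightarrow> 'a mat" where
  "transformed_blocks nb x Ab t j = x t j \<cdot>\<^sub>m Ab t (j mod nb)"

end

theory Submission
  imports Defs "Jordan_Normal_Form.Determinant"
begin

text \<open>
  The new code is MDS iff, for every \<open>r\<close>-subset \<open>S\<close> of nodes, the determinant of the corresponding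
  square block matrix, viewed as a function \<open>f S\<close> of the coefficients \<open>x (t, j)\<close>, does not vanish.
  As a function of the single coefficient \<open>x (t, j)\<close>, \<open>f S\<close> is a polynomial of degree at most \<open>N\<close>,
  constant if \<open>j \<notin> S\<close>. The coefficients are chosen nonzero one at a time, so that every \<open>f S\<close>
  keeps a completion at which it does not vanish: each step excludes \<open>0\<close> and, for each of the
  \<open>(n - 1) choose (r - 1)\<close> sets \<open>S\<close> containing \<open>j\<close>, at most \<open>N\<close> roots.
\<close>

section \<open>Common nonzeros of finitely many functions that are polynomial in each
  variable\<close>

lemma simultaneous_nonroot:
  fixes f :: "'i \<Rightarrow> ('v \<Rightarrow> 'a::{field,finite}) \<Rightarrow> 'a"
  assumes "finite V" and "finite I"
    and nonzero: "\<And>i. i \<in> I \<Longrightarrow> \<exists>y. f i y \<noteq> 0"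
    and univariate: "\<And>i v y. i \<in> I \<Longrightarrow> v \<in> V \<Longrightarrow>
      \<exists>p. degree p \<le> D \<and> (\<forall>a. f i (y(v := a)) = poly p a)"
    and independent: "\<And>i v y a. i \<in> I \<Longrightarrow> v \<in> V \<Longrightarrow> i \<notin> U v \<Longrightarrow> f i (y(v := a)) = f i y"
    and U: "\<And>v. v \<in> V \<Longrightarrow> U v \<subseteq> I"
    and bound: "\<And>v. v \<in> V \<Longrightarrow> card (U v) * D + 1 < CARD('a)"
  shows "\<exists>x. (\<forall>v\<in>V. x v \<noteq> 0) \<and> (\<forall>i\<in>I. \<exists>y. (\<forall>v\<in>V. y v = x v) \<and> f i y \<noteq> 0)"
  using \<open>finite V\<close> nonzero univariate independent U bound
proof (induction V)
  case empty
  then show ?case by simp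
next
  case (insert v V)
  have "\<exists>x. (\<forall>w\<in>V. x w \<noteq> 0) \<and> (\<forall>i\<in>I. \<exists>y. (\<forall>w\<in>V. y w = x w) \<and> f i y \<noteq> 0)"
    by (rule insert.IH) (use insert.prems in simp_all)
  then obtain x where x: "\<forall>w\<in>V. x w \<noteq> 0"
    and wit: "\<forall>i\<in>I. \<exists>y. (\<forall>w\<in>V. y w = x w) \<and> f i y \<noteq> 0"
    by blast
  \<comment> \<open>Each \<open>i\<close> has its own completion \<open>y i\<close>; it is tied to
    \<open>x\<close> on \<open>V\<close> only, so the values at \<open>v\<close> may differ from one
    \<open>i\<close> to another.\<close>
  from wit obtain y where y: "\<And>i w. i \<in> I \<Longrightarrow> w \<in> V \<Longrightarrow> y i w = x w"
    and fy: "\<And>i. i \<in> I \<Longrightarrow> f i (y i) \<noteq> 0"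
    by metis
  have "\<forall>i\<in>I. \<exists>p. degree p \<le> D \<and> (\<forall>a. f i ((y i)(v := a)) = poly p a)"
    using insert.prems(2) by blast
  then obtain p where deg: "\<And>i. i \<in> I \<Longrightarrow> degree (p i) \<le> D"
    and p: "\<And>i a. i \<in> I \<Longrightarrow> f i ((y i)(v := a)) = poly (p i) a"
    by metis
  \<comment> \<open>At \<open>a = y i v\<close> the update changes nothing, so \<open>p i\<close>
    takes there the nonzero value \<open>f i (y i)\<close>.\<close>
  have p0: "p i \<noteq> 0" if "i \<in> I" for i
    using p[OF that, of "y i v"] fy[OF that] by auto
  have Uv: "U v \<subseteq> I"
    using insert.prems(4) by simp
  with \<open>finite I\<close> have finU: "finite (U v)"
    by (rule rev_finite_subset)
  \<comment> \<open>For \<open>i\<close> outside \<open>U v\<close> the value does not depend on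
    \<open>v\<close>, so only the roots for \<open>i \<in> U v\<close> must be avoided. The extra
    \<open>0\<close> keeps the new coefficient nonzero and accounts for the \<open>+ 1\<close> in
    \<open>bound\<close>.\<close>
  let ?bad = "insert 0 (\<Union>i\<in>U v. {a. poly (p i) a = 0})"
  have "card ?bad \<le> Suc (card (\<Union>i\<in>U v. {a. poly (p i) a = 0}))"
    by (rule card_insert_le_m1) auto
  also have "card (\<Union>i\<in>U v. {a. poly (p i) a = 0}) \<le> (\<Sum>i\<in>U v. card {a. poly (p i) a = 0})"
    using finU by (rule card_UN_le)
  also have "\<dots> \<le> (\<Sum>i\<in>U v. D)"
  proof (rule sum_mono)
    fix i assume "i \<in> U v"
    with Uv have "i \<in> I" by blast
    from card_poly_roots_bound[OF p0[OF this]] deg[OF this]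
    show "card {a. poly (p i) a = 0} \<le> D" by (rule order_trans)
  qed
  finally have "card ?bad < CARD('a)"
    using insert.prems(5)[of v] by simp
  then have "?bad \<noteq> UNIV"
    by (metis less_irrefl)
  then obtain a where a: "a \<notin> ?bad"
    by blast
  have "f i ((y i)(v := a)) \<noteq> 0" if "i \<in> I" for i
  proof (cases "i \<in> U v")
    case True
    then show ?thesis using a p[OF that] by auto
  next
    case False
    then show ?thesis using insert.prems(3)[OF that insertI1] fy[OF that] by metis
  qed
  moreover have "\<forall>w\<in>insert v V. ((y i)(v := a)) w = (x(v := a)) w" if "i \<in> I" for i
    using y[OF that] by simp
  moreover have "\<forall>w\<in>insert v V. (x(v := a)) w \<noteq> 0"
    using x a by simp
  ultimately show ?case
    by (intro exI[of _ "x(v := a)"]) metis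
qed

section \<open>Determinants of matrices with polynomial entries\<close>

text \<open>Each term of the Leibniz expansion takes exactly one entry from every row. The bound is
  per row because later only \<open>N\<close> of the rows contain the variable.\<close>

lemma degree_det_le_sum_rows:
  assumes A: "A \<in> carrier_mat n n"
    and deg: "\<And>i j. i < n \<Longrightarrow> j < n \<Longrightarrow> degree (A $$ (i,j)) \<le> d i"
  shows "degree (det A) \<le> (\<Sum>i<n. d i)"
proof -
  have "degree (signof p * (\<Prod>i = 0..<n. A $$ (i, p i))) \<le> (\<Sum>i<n. d i)"
    if p: "p permutes {0..<n}" for p
  proof -
    have "degree (signof p * (\<Prod>i = 0..<n. A $$ (i, p i))) \<le> degree (\<Prod>i = 0..<n. A $$ (i, p i))"
      by (rule order_trans[OF degree_mult_le]) simp
    also have "\<dots> \<le> (\<Sum>i = 0..<n. degree (A $$ (i, p i)))"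
      using degree_prod_sum_le[of "{0..<n}" "\<lambda>i. A $$ (i, p i)"] by (simp add: o_def)
    also have "\<dots> \<le> (\<Sum>i = 0..<n. d i)"
      using p by (intro sum_mono deg) auto
    finally show ?thesis by (simp add: atLeast0LessThan)
  qed
  then show ?thesis
    unfolding det_def'[OF A] by (intro degree_sum_le) (auto simp: finite_permutations)
qed

text \<open>Evaluation at \<open>a\<close> is a ring homomorphism, and these commute with
  determinants.\<close>

lemma poly_det: "poly (det A) a = det (map_mat (\<lambda>p. poly p a) A)"
proof -
  interpret comm_ring_hom "\<lambda>p. poly p a"
    by standard auto
  show ?thesis by (simp add: hom_det)
qed

section \<open>Block matrices and their kernels\<close>

text \<open>Flattening makes non-singularity of a matrix of blocks a statement about one scalar
  determinant.\<close>

definition block_mat :: "nat \<Rightarrow> nat \<Rightarrow> (nat \<Rightarrow> nat \<Rightarrow> 'a mat) \<Rightarrow> 'a mat" where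
  "block_mat r N B = mat (r * N) (r * N) (\<lambda>(i, j). B (i div N) (j div N) $$ (i mod N, j mod N))"

lemma block_mat_carrier [simp]: "block_mat r N B \<in> carrier_mat (r * N) (r * N)"
  by (simp add: block_mat_def)

lemma sum_mult_blocks:
  fixes g :: "nat \<Rightarrow> 'a::comm_monoid_add"
  shows "(\<Sum>j<r * N. g j) = (\<Sum>p<r. \<Sum>w<N. g (p * N + w))"
proof -
  have "(\<Sum>j<r * N. g j) = (\<Sum>p<r. sum g {p * N..<p * N + N})"
    by (simp add: sum.nat_group)
  also have "\<dots> = (\<Sum>p<r. \<Sum>w<N. g (p * N + w))"
  proof (rule sum.cong)
    fix p
    show "sum g {p * N..<p * N + N} = (\<Sum>w<N. g (p * N + w))"
      using sum.shift_bounds_nat_ivl[of g 0 "p * N" N]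
      by (simp add: atLeast0LessThan add.commute)
  qed simp
  finally show ?thesis .
qed

lemma block_index_less:
  fixes p r w N :: nat
  assumes "p < r" "w < N"
  shows "p * N + w < r * N"
proof -
  have "p * N + w < Suc p * N" using assms by simp
  also have "\<dots> \<le> r * N" using assms by (intro mult_right_mono) auto
  finally show ?thesis .
qed

lemma index_block_mat_mult_vec:
  fixes B :: "nat \<Rightarrow> nat \<Rightarrow> 'a::comm_ring_1 mat"
  assumes "t < r" "u < N" "dim_vec v = r * N"
  shows "(block_mat r N B *\<^sub>v v) $ (t * N + u) =
    (\<Sum>p<r. \<Sum>w<N. B t p $$ (u, w) * v $ (p * N + w))"
proof -
  have lt: "t * N + u < r * N" using assms by (intro block_index_less)
  then have "(block_mat r N B *\<^sub>v v) $ (t * N + u) =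
    (\<Sum>j<r * N. B t (j div N) $$ (u, j mod N) * v $ j)"
    using assms by (auto simp: block_mat_def scalar_prod_def atLeast0LessThan intro!: sum.cong)
  also have "\<dots> = (\<Sum>p<r. \<Sum>w<N. B t p $$ (u, w) * v $ (p * N + w))"
    unfolding sum_mult_blocks by (intro sum.cong refl) auto
  finally show ?thesis .
qed

text \<open>A square matrix over an integral domain is singular iff it kills a nonzero vector.
  Indexing that vector by block and offset, \<open>z p w\<close> in place of entry
  \<open>p * N + w\<close>, keeps index arithmetic out of the later arguments.\<close>

lemma det_block_mat_eq_0_iff:
  fixes B :: "nat \<Rightarrow> nat \<Rightarrow> 'a::idom mat"
  assumes N: "0 < N"
  shows "det (block_mat r N B) = 0 \<longleftrightarrow>
    (\<exists>z. (\<forall>t<r. \<forall>u<N. (\<Sum>p<r. \<Sum>w<N. B t p $$ (u, w) * z p w) = 0) \<and>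
         (\<exists>p<r. \<exists>w<N. z p w \<noteq> 0))" (is "_ = (\<exists>z. ?kernel z \<and> ?nontrivial z)")
proof
  assume "det (block_mat r N B) = 0"
  then obtain v where v: "v \<in> carrier_vec (r * N)" "v \<noteq> 0\<^sub>v (r * N)"
    and Bv: "block_mat r N B *\<^sub>v v = 0\<^sub>v (r * N)"
    by (auto simp: det_0_iff_vec_prod_zero[OF block_mat_carrier])
  let ?z = "\<lambda>p w. v $ (p * N + w)"
  have "?kernel ?z"
  proof (intro allI impI)
    fix t u assume "t < r" "u < N"
    then show "(\<Sum>p<r. \<Sum>w<N. B t p $$ (u, w) * ?z p w) = 0"
      using index_block_mat_mult_vec[of t r u N v B] v Bv block_index_less[of t r u N] by simp
  qed
  moreover from v obtain j where j: "j < r * N" "v $ j \<noteq> 0"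
    by (metis eq_vecI carrier_vecD index_zero_vec)
  then have "j div N < r" "j mod N < N" "?z (j div N) (j mod N) \<noteq> 0"
    using N by (auto simp: less_mult_imp_div_less)
  then have "?nontrivial ?z" by blast
  ultimately show "\<exists>z. ?kernel z \<and> ?nontrivial z" by (intro exI[of _ ?z] conjI)
next
  assume "\<exists>z. ?kernel z \<and> ?nontrivial z"
  then obtain z p w where z: "?kernel z" and pw: "p < r" "w < N" "z p w \<noteq> 0" by blast
  let ?v = "vec (r * N) (\<lambda>j. z (j div N) (j mod N))"
  have z_eq: "?v $ (p * N + w) = z p w" if "p < r" "w < N" for p w
    using that block_index_less[of p r w N] by simp
  have "block_mat r N B *\<^sub>v ?v = 0\<^sub>v (r * N)"
  proof (rule eq_vecI)
    fix i assume "i < dim_vec (0\<^sub>v (r * N) :: 'a vec)"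
    then have i: "i < r * N" by simp
    then have lt: "i div N < r" "i mod N < N" using N by (auto simp: less_mult_imp_div_less)
    have "(block_mat r N B *\<^sub>v ?v) $ (i div N * N + i mod N) =
      (\<Sum>p<r. \<Sum>w<N. B (i div N) p $$ (i mod N, w) * ?v $ (p * N + w))"
      using lt by (intro index_block_mat_mult_vec) auto
    also have "\<dots> = (\<Sum>p<r. \<Sum>w<N. B (i div N) p $$ (i mod N, w) * z p w)"
      using z_eq by (intro sum.cong refl) auto
    also have "\<dots> = 0" using z lt by blast
    finally show "(block_mat r N B *\<^sub>v ?v) $ i = 0\<^sub>v (r * N) $ i" using i by simp
  qed (simp add: block_mat_def)
  moreover have "?v \<noteq> 0\<^sub>v (r * N)"
    using pw(3) z_eq[OF pw(1,2)] block_index_less[OF pw(1,2)] by (metis index_zero_vec(1))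
  ultimately show "det (block_mat r N B) = 0"
    unfolding det_0_iff_vec_prod_zero[OF block_mat_carrier] by (intro exI[of _ ?v]) simp
qed

lemma invertible_mat_kernel:
  fixes A :: "'a::field mat"
  assumes A: "A \<in> carrier_mat N N" "invertible_mat A"
    and ker: "\<And>u. u < N \<Longrightarrow> (\<Sum>w<N. A $$ (u, w) * z w) = 0" and w: "w < N"
  shows "z w = 0"
proof -
  from A obtain B where BA: "B * A = 1\<^sub>m (dim_row B)" and AB: "A * B = 1\<^sub>m N"
    unfolding invertible_mat_def inverts_mat_def by auto
  \<comment> \<open>\<open>invertible_mat\<close> does not state the size of the inverse; the two
    products force it.\<close>
  have B: "B \<in> carrier_mat N N"
    using A(1) BA AB by (metis carrier_matD carrier_matI index_mult_mat(2,3) index_one_mat(2,3))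
  have "A *\<^sub>v vec N z = 0\<^sub>v N"
    using A(1) ker by (auto simp: scalar_prod_def atLeast0LessThan)
  then have "(B * A) *\<^sub>v vec N z = 0\<^sub>v N"
    using A(1) B by (auto simp: assoc_mult_mat_vec[of _ N N _ N] scalar_prod_def)
  then have "vec N z = 0\<^sub>v N" using BA B by simp
  then show ?thesis using w by (metis index_vec index_zero_vec(1))
qed


section \<open>Determinants of selected nodes as functions of the coefficients\<close>

text \<open>For \<open>card S = r\<close> this is the determinant in the MDS condition for the nodes
  in \<open>S\<close>, taken in increasing order. Coefficients are indexed by pairs, so that a
  single one can be changed by a function update.\<close>

definition selected_det ::
  "nat \<Rightarrow> nat \<Rightarrow> (nat \<Rightarrow> nat \<Rightarrow> 'a::comm_ring_1 mat) \<Rightarrow> nat set \<Rightarrow> (nat \<times> nat \<Rightarrow> 'a) \<Rightarrow> 'a" where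
  "selected_det r N A S x =
     det (block_mat r N (\<lambda>t p. let j = sorted_list_of_set S ! p in x (t, j) \<cdot>\<^sub>m A t j))"

lemma block_mat_cong:
  assumes "\<And>t p. t < r \<Longrightarrow> p < r \<Longrightarrow> A t p = B t p"
  shows "block_mat r N A = block_mat r N B"
  unfolding block_mat_def using assms
  by (intro eq_matI) (auto simp: less_mult_imp_div_less)

lemma bij_betw_sorted_list_nth:
  "finite S \<Longrightarrow> card S = r \<Longrightarrow> bij_betw (\<lambda>p. sorted_list_of_set S ! p) {..<r} S"
  by (rule bij_betw_nth) auto

text \<open>Counts the scalar rows in block row \<open>t0\<close>, the only ones in which a
  coefficient with first index \<open>t0\<close> can occur.\<close>

lemma sum_single_block:
  "t0 < r \<Longrightarrow> (\<Sum>i<r * N. if i div N = t0 then 1 else 0) = (N :: nat)"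
proof -
  assume "t0 < r"
  have "(\<Sum>i<r * N. if i div N = t0 then 1 else 0) =
    (\<Sum>p<r. \<Sum>w<N. if p = t0 then 1 else 0 :: nat)"
    unfolding sum_mult_blocks by (intro sum.cong refl) auto
  also have "\<dots> = (\<Sum>p<r. if p = t0 then N else 0)"
    by (intro sum.cong refl) auto
  also have "\<dots> = N" using \<open>t0 < r\<close> by simp
  finally show ?thesis .
qed

text \<open>The coefficient at \<open>(t0, j0)\<close> scales at most one block, so it occurs only
  in the \<open>N\<close> rows of block row \<open>t0\<close>, and there linearly.\<close>

lemma selected_det_univariate:
  assumes A: "\<And>t j. t < r \<Longrightarrow> j \<in> S \<Longrightarrow> A t j \<in> carrier_mat N N"
    and S: "finite S" "card S = r" and t0: "t0 < r" and N: "0 < N"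
  shows "\<exists>p. degree p \<le> N \<and> (\<forall>a. selected_det r N A S (y((t0, j0) := a)) = poly p a)"
proof (intro exI conjI allI)
  let ?e = "\<lambda>p. sorted_list_of_set S ! p"
  define c where "c i j = A (i div N) (?e (j div N)) $$ (i mod N, j mod N)" for i j
  \<comment> \<open>The selected matrix with the coefficient at \<open>(t0, j0)\<close> replaced by
    the indeterminate; all other entries are constant polynomials.\<close>
  define M where "M = mat (r * N) (r * N) (\<lambda>(i, j).
    if (i div N, ?e (j div N)) = (t0, j0) then [:0, c i j:]
    else [:y (i div N, ?e (j div N)) * c i j:])"
  have M: "M \<in> carrier_mat (r * N) (r * N)" by (simp add: M_def)
  have "degree (det M) \<le> (\<Sum>i<r * N. if i div N = t0 then 1 else 0)"
    using M by (rule degree_det_le_sum_rows) (auto simp: M_def)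
  then show "degree (det M) \<le> N" using sum_single_block[OF t0] by simp
  fix a
  have eS: "?e p \<in> S" if "p < r" for p
    using bij_betwE[OF bij_betw_sorted_list_nth[OF S]] that by auto
  have "block_mat r N (\<lambda>t p. let j = ?e p in (y((t0, j0) := a)) (t, j) \<cdot>\<^sub>m A t j) =
    map_mat (\<lambda>p. poly p a) M"
  proof (rule eq_matI)
    fix i j assume "i < dim_row (map_mat (\<lambda>p. poly p a) M)" "j < dim_col (map_mat (\<lambda>p. poly p a) M)"
    then have ij: "i < r * N" "j < r * N" by (auto simp: M_def)
    then have "i div N < r" "j div N < r" by (auto simp: less_mult_imp_div_less)
    then have "A (i div N) (?e (j div N)) \<in> carrier_mat N N" by (intro A eS)
    then show "block_mat r N (\<lambda>t p. let j = ?e p in (y((t0, j0) := a)) (t, j) \<cdot>\<^sub>m A t j) $$ (i, j) =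
      map_mat (\<lambda>p. poly p a) M $$ (i, j)"
      using ij N by (auto simp: block_mat_def M_def c_def Let_def)
  qed (auto simp: M_def block_mat_def)
  then show "selected_det r N A S (y((t0, j0) := a)) = poly (det M) a"
    unfolding selected_det_def poly_det by simp
qed

text \<open>No column block belongs to the node \<open>j0\<close>, so the changed coefficient does
  not occur.\<close>

lemma selected_det_update_outside:
  assumes S: "finite S" "card S = r" and "j0 \<notin> S"
  shows "selected_det r N A S (y((t0, j0) := a)) = selected_det r N A S y"
proof -
  have "sorted_list_of_set S ! p \<noteq> j0" if "p < r" for p
    using bij_betwE[OF bij_betw_sorted_list_nth[OF S]] that assms(3) by auto
  then show ?thesis
    unfolding selected_det_def by (intro arg_cong[where f = det] block_mat_cong) (auto simp: Let_def)
qed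

text \<open>Moves nonvanishing from a completion to the chosen assignment once all relevant
  coefficients are fixed.\<close>

lemma selected_det_cong:
  assumes S: "finite S" "card S = r" and "\<And>t j. t < r \<Longrightarrow> j \<in> S \<Longrightarrow> x (t, j) = y (t, j)"
  shows "selected_det r N A S x = selected_det r N A S y"
proof -
  have "sorted_list_of_set S ! p \<in> S" if "p < r" for p
    using bij_betwE[OF bij_betw_sorted_list_nth[OF S]] that by auto
  then show ?thesis
    unfolding selected_det_def using assms(3)
    by (intro arg_cong[where f = det] block_mat_cong) (auto simp: Let_def)
qed

text \<open>Zero coefficients are allowed here, so the witness can make the block matrix block diagonal.\<close>

lemma selected_det_nonzero:
  fixes A :: "nat \<Rightarrow> nat \<Rightarrow> 'a::field mat"
  assumes A: "\<And>t j. t < r \<Longrightarrow> j \<in> S \<Longrightarrow> A t j \<in> carrier_mat N N \<and> invertible_mat (A t j)"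
    and S: "finite S" "card S = r" and N: "0 < N"
  shows "\<exists>y. selected_det r N A S y \<noteq> 0"
proof
  let ?e = "\<lambda>p. sorted_list_of_set S ! p"
  let ?y = "\<lambda>(t, j). if j = ?e t then 1 else 0 :: 'a"
  let ?B = "\<lambda>t p. let j = ?e p in ?y (t, j) \<cdot>\<^sub>m A t j"
  have bij: "bij_betw ?e {..<r} S" using S by (rule bij_betw_sorted_list_nth)
  have eS: "?e p \<in> S" if "p < r" for p using bij_betwE[OF bij] that by auto
  have inj: "?e p = ?e t \<longleftrightarrow> p = t" if "p < r" "t < r" for p t
    using bij_betw_imp_inj_on[OF bij] that by (auto dest: inj_onD)
  have "z t w = 0" if z: "\<forall>t<r. \<forall>u<N. (\<Sum>p<r. \<Sum>w<N. ?B t p $$ (u, w) * z p w) = 0"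
    and t: "t < r" and w: "w < N" for z t w
  proof (rule invertible_mat_kernel)
    show "A t (?e t) \<in> carrier_mat N N" "invertible_mat (A t (?e t))"
      using A t eS by auto
    fix u assume u: "u < N"
    \<comment> \<open>As the enumeration \<open>?e\<close> is injective, block row \<open>t\<close>
      has coefficient 1 only at \<open>p = t\<close>. Its equations thus involve only the invertible
      block \<open>A t (?e t)\<close>.\<close>
    have "(\<Sum>p<r. \<Sum>w<N. ?B t p $$ (u, w) * z p w) =
      (\<Sum>p<r. if p = t then \<Sum>w<N. A t (?e t) $$ (u, w) * z t w else 0)"
    proof (rule sum.cong)
      fix p assume "p \<in> {..<r}"
      then have p: "p < r" by simp
      have "A t (?e p) \<in> carrier_mat N N" using A t eS p by auto
      then show "(\<Sum>w<N. ?B t p $$ (u, w) * z p w) =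
        (if p = t then \<Sum>w<N. A t (?e t) $$ (u, w) * z t w else 0)"
        using u inj[OF p t] by (auto simp: Let_def intro!: sum.cong sum.neutral)
    qed simp
    then show "(\<Sum>w<N. A t (?e t) $$ (u, w) * z t w) = 0"
      using z t u by (auto simp: sum.delta)
  qed (rule w)
  then show "selected_det r N A S ?y \<noteq> 0"
    unfolding selected_det_def det_block_mat_eq_0_iff[OF N] by blast
qed

section \<open>From nonzero determinants to the MDS property\<close>

lemma one_smult_mat: "(1 :: 'a::monoid_mult) \<cdot>\<^sub>m A = A"
  by (intro eq_matI) auto

text \<open>Two codewords that agree on \<open>k\<close> nodes differ by a kernel vector of the
  parity-check matrix supported on the other \<open>n - k\<close> nodes; the nonzero determinant
  there forces it to vanish. The coefficients are constantly 1 because any scaling is already part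
  of \<open>A\<close>.\<close>

lemma mds_array_codeI:
  fixes A :: "nat \<Rightarrow> nat \<Rightarrow> 'a::field mat"
  assumes pc: "parity_check_blocks n k N A"
    and nz: "\<And>S. S \<subseteq> {..<n} \<Longrightarrow> card S = n - k \<Longrightarrow> selected_det (n - k) N A S (\<lambda>_. 1) \<noteq> 0"
  shows "mds_array_code n k N A"
  unfolding mds_array_code_def
proof (intro conjI allI impI pc inj_onI)
  fix K f g
  assume K: "K \<subseteq> {..<n} \<and> card K = k"
    and f: "f \<in> array_code n k N A" and g: "g \<in> array_code n k N A"
    and eq: "restrict f K = restrict g K"
  have N: "0 < N" and kn: "k < n" and A: "\<And>t i. t < n - k \<Longrightarrow> i < n \<Longrightarrow> A t i \<in> carrier_mat N N"
    using pc by (auto simp: parity_check_blocks_def)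
  let ?r = "n - k"
  define S where "S = {..<n} - K"
  have S: "S \<subseteq> {..<n}" "finite S" "card S = ?r"
    using K by (auto simp: S_def card_Diff_subset finite_subset)
  let ?e = "\<lambda>p. sorted_list_of_set S ! p"
  have bij: "bij_betw ?e {..<?r} S" using S(2,3) by (rule bij_betw_sorted_list_nth)
  have eS: "?e p < n" if "p < ?r" for p using bij_betwE[OF bij] that S(1) by auto
  have carr: "h i \<in> carrier_vec N" if "h \<in> array_code n k N A" "i < n" for h i
    using that by (auto simp: array_code_def)
  \<comment> \<open>The parity checks entry by entry, the form in which
    \<open>det_block_mat_eq_0_iff\<close> describes kernels.\<close>
  have syndrome: "(\<Sum>i<n. \<Sum>w<N. A t i $$ (u, w) * h i $ w) = 0"
    if h: "h \<in> array_code n k N A" and t: "t < ?r" and u: "u < N" for h t u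
  proof -
    have "(\<Sum>i<n. \<Sum>w<N. A t i $$ (u, w) * h i $ w) = (\<Sum>i<n. (A t i *\<^sub>v h i) $ u)"
    proof (rule sum.cong)
      fix i assume "i \<in> {..<n}"
      then have "A t i \<in> carrier_mat N N" "h i \<in> carrier_vec N" using A t carr h by auto
      then show "(\<Sum>w<N. A t i $$ (u, w) * h i $ w) = (A t i *\<^sub>v h i) $ u"
        using u by (auto simp: scalar_prod_def atLeast0LessThan)
    qed simp
    also have "\<dots> = finsum_vec TYPE('a) N (\<lambda>i. A t i *\<^sub>v h i) {..<n} $ u"
      using u A t carr h by (subst index_finsum_vec) (auto intro!: mult_mat_vec_carrier)
    also have "\<dots> = 0" using h t u by (auto simp: array_code_def)
    finally show ?thesis .
  qed
  define z where "z i w = f i $ w - g i $ w" for i w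
  have zK: "z i w = 0" if "i \<in> K" for i w
    using fun_cong[OF eq, of i] that by (simp add: z_def)
  have ker: "(\<Sum>p<?r. \<Sum>w<N. (1 \<cdot>\<^sub>m A t (?e p)) $$ (u, w) * z (?e p) w) = 0"
    if t: "t < ?r" and u: "u < N" for t u
  proof -
    have "(\<Sum>p<?r. \<Sum>w<N. (1 \<cdot>\<^sub>m A t (?e p)) $$ (u, w) * z (?e p) w) =
      (\<Sum>p<?r. \<Sum>w<N. A t (?e p) $$ (u, w) * z (?e p) w)"
      by (simp only: one_smult_mat)
    also have "\<dots> = (\<Sum>i\<in>S. \<Sum>w<N. A t i $$ (u, w) * z i w)"
      using bij by (rule sum.reindex_bij_betw)
    \<comment> \<open>Extending the sum from \<open>S\<close> to all nodes adds only zeros, since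
      the codewords agree on \<open>K\<close>.\<close>
    also have "\<dots> = (\<Sum>i<n. \<Sum>w<N. A t i $$ (u, w) * z i w)"
      by (rule sum.mono_neutral_left) (auto simp: S_def zK)
    also have "\<dots> = 0"
      using syndrome[OF f t u] syndrome[OF g t u]
      by (simp add: z_def right_diff_distrib sum_subtractf)
    finally show ?thesis .
  qed
  have zS: "z (?e p) w = 0" if "p < ?r" "w < N" for p w
  proof (rule ccontr)
    assume "z (?e p) w \<noteq> 0"
    then have "\<exists>p<?r. \<exists>w<N. z (?e p) w \<noteq> 0"
      using that by blast
    with ker have "det (block_mat ?r N (\<lambda>t p. 1 \<cdot>\<^sub>m A t (?e p))) = 0"
      unfolding det_block_mat_eq_0_iff[OF N] by (intro exI[of _ "\<lambda>p. z (?e p)"]) simp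
    with nz[OF S(1,3)] show False
      unfolding selected_det_def Let_def by contradiction
  qed
  have zero: "z i w = 0" if "i < n" "w < N" for i w
  proof (cases "i \<in> K")
    case True
    then show ?thesis by (rule zK)
  next
    case False
    then have "i \<in> ?e ` {..<?r}" using that bij by (auto simp: S_def bij_betw_def)
    then show ?thesis using zS that by blast
  qed
  show "f = g"
  proof (rule ext)
    fix i
    show "f i = g i"
    proof (cases "i < n")
      case True
      show ?thesis
        using zero[OF True] carr[OF f True] carr[OF g True] by (intro eq_vecI) (auto simp: z_def)
    next
      \<comment> \<open>Outside the node range both codewords take the default value of extensional
        functions.\<close>
      case False
      then show ?thesis using f g by (auto simp: array_code_def PiE_def extensional_def)
    qed
  qed
qed

section \<open>Counting the affected determinants and choosing the coefficients\<close>

text \<open>Removing \<open>j\<close> leaves an arbitrary \<open>(r - 1)\<close>-subset of the other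
  \<open>n - 1\<close> nodes. This is the source of the binomial coefficient in the field size
  condition.\<close>

lemma card_subsets_containing:
  fixes n r j :: nat
  assumes "j < n" "0 < r"
  shows "card {S. S \<subseteq> {..<n} \<and> card S = r \<and> j \<in> S} = (n - 1) choose (r - 1)"
proof -
  have fin: "finite S" if "S \<subseteq> {..<n}" for S using that finite_subset by blast
  have "bij_betw (insert j) {T. T \<subseteq> {..<n} - {j} \<and> card T = r - 1}
    {S. S \<subseteq> {..<n} \<and> card S = r \<and> j \<in> S}"
  proof (rule bij_betw_byWitness[where f' = "\<lambda>S. S - {j}"])
    show "insert j ` {T. T \<subseteq> {..<n} - {j} \<and> card T = r - 1} \<subseteq>
      {S. S \<subseteq> {..<n} \<and> card S = r \<and> j \<in> S}"
    proof clarify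
      fix T assume T: "T \<subseteq> {..<n} - {j}" "card T = r - 1"
      then have "finite T" "j \<notin> T" using fin by auto
      then show "insert j T \<subseteq> {..<n} \<and> card (insert j T) = r \<and> j \<in> insert j T"
        using T assms by auto
    qed
  qed (use assms fin in auto)
  then have "card {S. S \<subseteq> {..<n} \<and> card S = r \<and> j \<in> S} =
    card {T. T \<subseteq> {..<n} - {j} \<and> card T = r - 1}"
    by (rule bij_betw_same_card[symmetric])
  also have "\<dots> = card ({..<n} - {j}) choose (r - 1)"
    by (rule n_subsets) simp
  finally show ?thesis using assms by simp
qed

theorem theorem1:
  fixes Ab :: "nat \<Rightarrow> nat \<Rightarrow> 'a::{field,finite} mat"
    and nb kb db N s n k r q :: nat
  assumes q: "q = CARD('a)"
    and base: "msr_code nb kb db N Ab"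
    and degree: "db < nb - 1"
    and r: "r = nb - kb"
    and s: "s \<ge> 2"
    and n: "n = s * nb"
    and k: "k = n - r"
    and field_size: "q > N * ((n - 1) choose (r - 1)) + 1"
    and nonsingular: "\<forall>t<r. \<forall>j<nb. invertible_mat (Ab t j)"
  shows "\<exists>x :: nat \<Rightarrow> nat \<Rightarrow> 'a.
           (\<forall>t<r. \<forall>j<n. x t j \<noteq> 0) \<and>
           mds_array_code n k N (transformed_blocks nb x Ab)"
proof -
  have kb: "0 < kb" "kb < nb" and N: "0 < N"
    and Ab: "\<And>t i. t < r \<Longrightarrow> i < nb \<Longrightarrow> Ab t i \<in> carrier_mat N N"
    using base by (auto simp: msr_code_def mds_array_code_def parity_check_blocks_def r)
  \<comment> \<open>Since \<open>r < nb \<le> n\<close>, the truncated subtractions are exact: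
    \<open>k\<close> is positive and the new code has \<open>r\<close> parity-check block rows, like
    the base code.\<close>
  have "nb \<le> n" using s by (simp add: n)
  then have r_bounds: "0 < r" "r < n" and k_bounds: "0 < k" "k < n" and nk: "n - k = r"
    using kb by (auto simp: r k)
  \<comment> \<open>The base blocks repeated with period \<open>nb\<close>, with the coefficients
    left out.\<close>
  define A where "A t j = Ab t (j mod nb)" for t j
  have A: "A t j \<in> carrier_mat N N" "invertible_mat (A t j)" if "t < r" for t j
    using that kb Ab nonsingular by (auto simp: A_def)
  let ?I = "{S. S \<subseteq> {..<n} \<and> card S = r}"
  let ?V = "{..<r} \<times> {..<n}"
  \<comment> \<open>The determinants that can depend on the coefficient at \<open>v = (t, j)\<close>
    are those whose node set contains \<open>j\<close>.\<close>
  let ?U = "\<lambda>v :: nat \<times> nat. {S. S \<subseteq> {..<n} \<and> card S = r \<and> snd v \<in> S}"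
  have fin: "finite S" if "S \<in> ?I" for S using that finite_subset by blast
  have "\<exists>x. (\<forall>v\<in>?V. x v \<noteq> 0) \<and>
    (\<forall>S\<in>?I. \<exists>y. (\<forall>v\<in>?V. y v = x v) \<and> selected_det r N A S y \<noteq> 0)"
  proof (rule simultaneous_nonroot[where U = ?U and D = N])
    show "finite ?V" "finite ?I" by auto
    show "\<exists>y. selected_det r N A S y \<noteq> 0" if "S \<in> ?I" for S
      using that A fin[OF that] N by (intro selected_det_nonzero) simp_all
    show "\<exists>p. degree p \<le> N \<and> (\<forall>a. selected_det r N A S (y(v := a)) = poly p a)"
      if "S \<in> ?I" "v \<in> ?V" for S v y
      using selected_det_univariate[of r S A N "fst v" y "snd v"] that A(1) fin[OF that(1)] N
      by (simp add: mem_Times_iff)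
    show "selected_det r N A S (y(v := a)) = selected_det r N A S y"
      if "S \<in> ?I" "v \<in> ?V" "S \<notin> ?U v" for S v y a
      using selected_det_update_outside[of S r "snd v" N A y "fst v" a] that fin[OF that(1)]
      by simp
    show "?U v \<subseteq> ?I" for v by auto
    show "card (?U v) * N + 1 < CARD('a)" if "v \<in> ?V" for v
      using that card_subsets_containing[of "snd v" n r] r_bounds field_size
      by (simp add: q mult.commute mem_Times_iff)
  qed
  then obtain x where x: "\<forall>v\<in>?V. x v \<noteq> 0"
    and wit: "\<forall>S\<in>?I. \<exists>y. (\<forall>v\<in>?V. y v = x v) \<and> selected_det r N A S y \<noteq> 0" by blast
  define X where "X t j = x (t, j)" for t j
  have "mds_array_code n k N (transformed_blocks nb X Ab)"
  proof (rule mds_array_codeI)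
    show "parity_check_blocks n k N (transformed_blocks nb X Ab)"
      using k_bounds N A nk by (auto simp: parity_check_blocks_def transformed_blocks_def A_def)
  next
    fix S assume S: "S \<subseteq> {..<n}" "card S = n - k"
    then have SI: "S \<in> ?I" using nk by simp
    with wit obtain y where y: "\<forall>v\<in>?V. y v = x v" "selected_det r N A S y \<noteq> 0" by blast
    have "selected_det r N (transformed_blocks nb X Ab) S (\<lambda>_. 1) = selected_det r N A S x"
      by (simp add: selected_det_def transformed_blocks_def A_def X_def Let_def one_smult_mat)
    \<comment> \<open>Every coefficient that enters has its index in \<open>?V\<close>, where the
      completion \<open>y\<close> has no freedom left and equals \<open>x\<close>.\<close>
    also have "\<dots> = selected_det r N A S y"
      using y(1) SI fin[OF SI] by (intro selected_det_cong) auto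
    finally show "selected_det (n - k) N (transformed_blocks nb X Ab) S (\<lambda>_. 1) \<noteq> 0"
      using y(2) by (simp add: nk)
  qed
  moreover have "\<forall>t<r. \<forall>j<n. X t j \<noteq> 0"
    using x by (simp add: X_def)
  ultimately show ?thesis by blast
qed

end
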